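(* Let $P$ be a normal logic program and let $M$ be a set of atoms. \begin{enumerate} \item $P$ is a Horn program if and only if $\mathit{mca}(P)$ is a Horn mca-program. \item If $P$ is a Horn program then the least model of $P$ is the only derivable model of $\mathit{mca}(P)$. \item $\{T_P(M)\}=T^{nd}_{\mathit{mca}(P)}(M)$. \item $\mathit{mca}(P^M) = \mathit{mca}(P)^M$. \item $M$ is a model (supported model, stable model) of $P$ if and only if $M$ is a model (supported model, stable model) of $\mathit{mca}(P)$. \end{enumerate}
   Context: Definitions. An mc-atom over a set of atoms $\mathit{At}$ is an expression $kX$ with $k$ a non-negative integer and $X\subseteq\mathit{At}$ finite, $k\le|X|$; a set $M$ satisfies $kX$ iff $|M\cap X|\ge k$, and satisfies $\mathbf{not}(kX)$ iff $|M\cap X|<k$. An mca-clause is $H\leftarrow L_1,\ldots,L_m$ with $H$ an mc-atom (the head $\mathit{hd}(r)$) and $L_i$ mc-literals (the body $\mathit{bd}(r)$); $\mathit{hset}(r)$ is the atom set of the head, and $\mathit{hset}(P)$ is the union of the $\mathit{hset}(r)$, $r\in P$. A clause/program is Horn if no body contains $\mathbf{not}(\cdot)$. $M$ is a model of an mca-program if it satisfies the head of each clause whose body it satisfies. For an mca-program $P$, $P(M)=\{r\in P: M\models\mathit{bd}(r)\}$ and $T^{nd}_P(M)$ is the set of all $M'\subseteq\mathit{hset}(P(M))$ such that $M'\models\mathit{hd}(r)$ for every $r\in P(M)$. $M$ is a supported model of $P$ if $M\in T^{nd}_P(M)$. For a Horn mca-program $P$, a $P$-computation is a sequence $X_0=\emptyset\subseteq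 X_1\subseteq\cdots$ with $X_{n+1}\in T^{nd}_P(X_n)$; a derivable model is the union $\bigcup_n X_n$ of some $P$-computation. The reduct $P^M$ of an mca-program removes every clause having a body literal $\mathbf{not}(A)$ with $M\models A$ and deletes all $\mathbf{not}(A)$ literals from the remaining clauses; $M$ is a stable model of $P$ if $M$ is a derivable model of $P^M$. For a normal clause $r = c\leftarrow a_1,\ldots,a_m,\mathbf{not}(b_1),\ldots,\mathbf{not}(b_n)$, $\mathit{mca}(r)$ is the mca-clause $1\{c\}\leftarrow 1\{a_1\},\ldots,1\{a_m\},\mathbf{not}(1\{b_1\}),\ldots,\mathbf{not}(1\{b_n\})$, and for a normal program $P$, $\mathit{mca}(P)=\{\mathit{mca}(r): r\in P\}$. For a normal program $P$, $T_P$ is the usual one-step provability operator, $P^M$ is the Gelfond–Lifschitz reduct, and models, supported models and stable models have their usual meaning. *)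

theory Defs
  imports Main
begin

text \<open>
  The set of atoms is the universe of the type variable \<^typ>\<open>'a\<close>.
  Programs are arbitrary (possibly infinite) sets of clauses; clause bodies are finite lists.
\<close>

section \<open>Normal logic programs\<close>

text \<open>\<open>Clause c [a\<^sub>1,\<dots>,a\<^sub>m] [b\<^sub>1,\<dots>,b\<^sub>n]\<close> stands for
  \<open>c \<leftarrow> a\<^sub>1,\<dots>,a\<^sub>m, not(b\<^sub>1),\<dots>,not(b\<^sub>n)\<close>.\<close>

datatype 'a clause = Clause (head: 'a) (pos: "'a list") (neg: "'a list")

type_synonym 'a program = "'a clause set"

definition horn :: "'a program \<Rightarrow> bool" where
  "horn P \<longleftrightarrow> (\<forall>r\<in>P. neg r = [])"

definition sat_body :: "'a set \<Rightarrow> 'a clause \<Rightarrow> bool" where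
  "sat_body M r \<longleftrightarrow> (\<forall>a\<in>set (pos r). a \<in> M) \<and> (\<forall>b\<in>set (neg r). b \<notin> M)"

definition model :: "'a program \<Rightarrow> 'a set \<Rightarrow> bool" where
  "model P M \<longleftrightarrow> (\<forall>r\<in>P. sat_body M r \<longrightarrow> head r \<in> M)"

definition least_model :: "'a program \<Rightarrow> 'a set \<Rightarrow> bool" where
  "least_model P M \<longleftrightarrow> model P M \<and> (\<forall>N. model P N \<longrightarrow> M \<subseteq> N)"

definition T :: "'a program \<Rightarrow> 'a set \<Rightarrow> 'a set" where
  "T P M = head ` {r \<in> P. sat_body M r}"

definition supported_model :: "'a program \<Rightarrow> 'a set \<Rightarrow> bool" where
  "supported_model P M \<longleftrightarrow>
     model P M \<and> (\<forall>a\<in>M. \<exists>r\<in>P. head r = a \<and> sat_body M r)"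

definition reduct :: "'a program \<Rightarrow> 'a set \<Rightarrow> 'a program" where
  "reduct P M = (\<lambda>r. Clause (head r) (pos r) []) ` {r \<in> P. \<forall>b\<in>set (neg r). b \<notin> M}"

definition stable_model :: "'a program \<Rightarrow> 'a set \<Rightarrow> bool" where
  "stable_model P M \<longleftrightarrow> least_model (reduct P M) M"


section \<open>Programs with monotone cardinality atoms\<close>

typedef 'a mc_atom = "{(k :: nat, X :: 'a set). finite X \<and> k \<le> card X}"
  by (rule exI [of _ "(0, {})"]) simp

text \<open>\<open>mc k X\<close> is the mc-atom \<open>kX\<close>; it is meaningful only for finite \<open>X\<close> with \<open>k \<le> |X|\<close>.\<close>

definition mc :: "nat \<Rightarrow> 'a set \<Rightarrow> 'a mc_atom" where
  "mc k X = Abs_mc_atom (k, X)"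

definition bound :: "'a mc_atom \<Rightarrow> nat" where
  "bound A = fst (Rep_mc_atom A)"

definition aset :: "'a mc_atom \<Rightarrow> 'a set" where
  "aset A = snd (Rep_mc_atom A)"

lemma bound_mc [simp]: "finite X \<Longrightarrow> k \<le> card X \<Longrightarrow> bound (mc k X) = k"
  by (simp add: bound_def mc_def Abs_mc_atom_inverse)

lemma aset_mc [simp]: "finite X \<Longrightarrow> k \<le> card X \<Longrightarrow> aset (mc k X) = X"
  by (simp add: aset_def mc_def Abs_mc_atom_inverse)

datatype 'a mc_literal = Pos "'a mc_atom" | Not "'a mc_atom"

datatype 'a mca_clause = MCA_Clause (hd_mca: "'a mc_atom") (bd_mca: "'a mc_literal list")

type_synonym 'a mca_program = "'a mca_clause set"

definition sat_atom :: "'a set \<Rightarrow> 'a mc_atom \<Rightarrow> bool" where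
  "sat_atom M A \<longleftrightarrow> card (M \<inter> aset A) \<ge> bound A"

fun sat_literal :: "'a set \<Rightarrow> 'a mc_literal \<Rightarrow> bool" where
  "sat_literal M (Pos A) \<longleftrightarrow> sat_atom M A"
| "sat_literal M (Not A) \<longleftrightarrow> card (M \<inter> aset A) < bound A"

definition sat_mca_body :: "'a set \<Rightarrow> 'a mca_clause \<Rightarrow> bool" where
  "sat_mca_body M r \<longleftrightarrow> (\<forall>L\<in>set (bd_mca r). sat_literal M L)"

definition mca_horn :: "'a mca_program \<Rightarrow> bool" where
  "mca_horn P \<longleftrightarrow> (\<forall>r\<in>P. \<forall>A. Not A \<notin> set (bd_mca r))"

definition mca_model :: "'a mca_program \<Rightarrow> 'a set \<Rightarrow> bool" where
  "mca_model P M \<longleftrightarrow> (\<forall>r\<in>P. sat_mca_body M r \<longrightarrow> sat_atom M (hd_mca r))"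

definition hset :: "'a mca_program \<Rightarrow> 'a set" where
  "hset P = (\<Union>r\<in>P. aset (hd_mca r))"

definition applicable :: "'a mca_program \<Rightarrow> 'a set \<Rightarrow> 'a mca_program" where
  "applicable P M = {r \<in> P. sat_mca_body M r}"

definition Tnd :: "'a mca_program \<Rightarrow> 'a set \<Rightarrow> 'a set set" where
  "Tnd P M = {M'. M' \<subseteq> hset (applicable P M) \<and> (\<forall>r\<in>applicable P M. sat_atom M' (hd_mca r))}"

definition mca_supported_model :: "'a mca_program \<Rightarrow> 'a set \<Rightarrow> bool" where
  "mca_supported_model P M \<longleftrightarrow> M \<in> Tnd P M"

definition computation :: "'a mca_program \<Rightarrow> (nat \<Rightarrow> 'a set) \<Rightarrow> bool" where
  "computation P X \<longleftrightarrow>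
     mca_horn P \<and> X 0 = {} \<and> (\<forall>n. X n \<subseteq> X (Suc n)) \<and> (\<forall>n. X (Suc n) \<in> Tnd P (X n))"

definition derivable_model :: "'a mca_program \<Rightarrow> 'a set \<Rightarrow> bool" where
  "derivable_model P M \<longleftrightarrow> (\<exists>X. computation P X \<and> M = (\<Union>n. X n))"

fun is_Pos :: "'a mc_literal \<Rightarrow> bool" where
  "is_Pos (Pos A) \<longleftrightarrow> True"
| "is_Pos (Not A) \<longleftrightarrow> False"

definition mca_reduct :: "'a mca_program \<Rightarrow> 'a set \<Rightarrow> 'a mca_program" where
  "mca_reduct P M =
     (\<lambda>r. MCA_Clause (hd_mca r) (filter is_Pos (bd_mca r))) `
       {r \<in> P. \<not> (\<exists>A. Not A \<in> set (bd_mca r) \<and> sat_atom M A)}"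

definition mca_stable_model :: "'a mca_program \<Rightarrow> 'a set \<Rightarrow> bool" where
  "mca_stable_model P M \<longleftrightarrow> derivable_model (mca_reduct P M) M"


section \<open>Normal programs as mca-programs\<close>

definition mca_clause :: "'a clause \<Rightarrow> 'a mca_clause" where
  "mca_clause r = MCA_Clause (mc 1 {head r})
     (map (\<lambda>a. Pos (mc 1 {a})) (pos r) @ map (\<lambda>b. Not (mc 1 {b})) (neg r))"

definition mca :: "'a program \<Rightarrow> 'a mca_program" where
  "mca P = mca_clause ` P"

end

theory Submission
  imports Defs
begin

text \<open>
  The mc-atom \<open>1{a}\<close> is satisfied exactly by the sets containing \<open>a\<close>, so normal clauses and their
  translations have the same satisfaction behaviour. Heads of translated clauses are satisfied by
  subsets of the head set only if all heads are included, so nondeterministic one-step provability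
  becomes deterministic. Hence the only computation of a translated Horn program consists of the
  iterates of the monotone operator \<open>T P\<close> from the empty set, and their union is the least
  model because bodies are finite.
\<close>

text \<open>The bound is written \<open>Suc 0\<close> because the simplifier normalises
  \<open>1\<close> to this form.\<close>

lemma sat_atom_mc_singleton [simp]: "sat_atom M (mc (Suc 0) {a}) \<longleftrightarrow> a \<in> M"
  by (cases "a \<in> M") (auto simp: sat_atom_def)

text \<open>Replaces the cardinality inequality in the defining equation, so that
  \<open>sat_atom_mc_singleton\<close> can rewrite negative literals too.\<close>

lemma sat_literal_Not: "sat_literal M (Not A) \<longleftrightarrow> \<not> sat_atom M A"
  by (auto simp: sat_atom_def)

lemma hd_mca_clause [simp]: "hd_mca (mca_clause r) = mc (Suc 0) {head r}"
  by (simp add: mca_clause_def)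

lemma bd_mca_clause:
  "bd_mca (mca_clause r) =
     map (\<lambda>a. Pos (mc 1 {a})) (pos r) @ map (\<lambda>b. Not (mc 1 {b})) (neg r)"
  by (simp add: mca_clause_def)

lemma sat_mca_body_mca_clause [simp]: "sat_mca_body M (mca_clause r) \<longleftrightarrow> sat_body M r"
  by (simp add: sat_mca_body_def sat_body_def bd_mca_clause ball_Un sat_literal_Not
      del: sat_literal.simps(2))

lemma mca_horn_mca:
  fixes P :: "'a program"
  shows "mca_horn (mca P) \<longleftrightarrow> horn P"
proof -
  have "(\<forall>A. Not A \<notin> set (bd_mca (mca_clause r))) \<longleftrightarrow> neg r = []" for r :: "'a clause"
    by (cases "neg r") (auto simp: bd_mca_clause)
  then show ?thesis
    by (simp add: mca_horn_def mca_def horn_def)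
qed

lemma mca_model_mca: "mca_model (mca P) M \<longleftrightarrow> model P M"
  by (simp add: mca_model_def mca_def model_def)

lemma Tnd_mca: "Tnd (mca P) M = {T P M}"
proof -
  have app: "applicable (mca P) M = mca_clause ` {r \<in> P. sat_body M r}"
    by (auto simp: applicable_def mca_def)
  then have "hset (applicable (mca P) M) = T P M"
    by (auto simp: hset_def T_def)
  \<comment> \<open>Lower bound on \<open>N\<close>; the head set computed above is the matching
    upper bound.\<close>
  moreover have "(\<forall>r\<in>applicable (mca P) M. sat_atom N (hd_mca r)) \<longleftrightarrow> T P M \<subseteq> N" for N
    by (auto simp: app T_def)
  ultimately show ?thesis
    by (auto simp: Tnd_def)
qed

lemma model_iff_T_subset: "model P M \<longleftrightarrow> T P M \<subseteq> M"
  by (auto simp: model_def T_def)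

text \<open>Being a model gives one inclusion, support of every atom the other.\<close>

lemma supported_model_iff_T_fixpoint: "supported_model P M \<longleftrightarrow> T P M = M"
proof -
  have "(\<forall>a\<in>M. \<exists>r\<in>P. head r = a \<and> sat_body M r) \<longleftrightarrow> M \<subseteq> T P M"
    by (fastforce simp: T_def)
  then show ?thesis
    by (auto simp: supported_model_def model_iff_T_subset)
qed

lemma mca_supported_model_mca: "mca_supported_model (mca P) M \<longleftrightarrow> supported_model P M"
  by (auto simp: mca_supported_model_def Tnd_mca supported_model_iff_T_fixpoint)

lemma mca_clause_strip_neg:
  "mca_clause (Clause (head r) (pos r) []) =
     MCA_Clause (hd_mca (mca_clause r)) (filter is_Pos (bd_mca (mca_clause r)))"
proof -
  have "filter is_Pos (map (\<lambda>a. Pos (mc 1 {a})) as) = map (\<lambda>a. Pos (mc 1 {a})) as"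
    and "filter is_Pos (map (\<lambda>b. Not (mc 1 {b})) bs) = []" for as bs :: "'a list"
    by (auto simp: filter_empty_conv)
  then show ?thesis
    by (simp add: mca_clause_def)
qed

text \<open>Both reducts discard the same clauses, and stripping negative literals commutes with the
  translation.\<close>

lemma mca_reduct_mca: "mca_reduct (mca P) M = mca (reduct P M)"
proof -
  have "{r \<in> mca P. \<not> (\<exists>A. Not A \<in> set (bd_mca r) \<and> sat_atom M A)}
      = mca_clause ` {r \<in> P. \<forall>b\<in>set (neg r). b \<notin> M}"
  proof -
    have "(\<exists>A. Not A \<in> set (bd_mca (mca_clause r)) \<and> sat_atom M A) \<longleftrightarrow>
        (\<exists>b\<in>set (neg r). b \<in> M)" for r
      by (auto simp: bd_mca_clause)
    then show ?thesis
      by (auto simp: mca_def)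
  qed
  then show ?thesis
    by (simp add: mca_reduct_def reduct_def mca_def image_image mca_clause_strip_neg)
qed

lemma mono_T: "horn P \<Longrightarrow> mono (T P)"
  unfolding mono_def horn_def T_def sat_body_def by fastforce

lemma incseq_T_iterates: "horn P \<Longrightarrow> mono (\<lambda>n. (T P ^^ n) {})"
  \<comment> \<open>Iterating a monotone function from the bottom element, here \<open>{}\<close>,
    yields an increasing chain.\<close>
  using funpow_decreasing [of _ _ "T P"] mono_T [of P] by (auto simp: mono_def)

lemma computation_mca_iff:
  assumes "horn P"
  shows "computation (mca P) X \<longleftrightarrow> X = (\<lambda>n. (T P ^^ n) {})"
proof
  assume "computation (mca P) X"
  then have "X 0 = {}" and "X (Suc n) = T P (X n)" for n
    by (auto simp: computation_def Tnd_mca)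
  then have "X n = (T P ^^ n) {}" for n
    by (induction n) simp_all
  then show "X = (\<lambda>n. (T P ^^ n) {})"
    by blast
next
  assume X: "X = (\<lambda>n. (T P ^^ n) {})"
  show "computation (mca P) X"
    \<comment> \<open>The \<open>monoD\<close> instance, fed with \<open>n \<le> Suc n\<close>, is
      the inclusion between consecutive stages.\<close>
    using assms monoD [OF incseq_T_iterates [OF assms] le_Suc_eq [THEN iffD2, OF disjI1, OF order_refl]]
    by (simp add: computation_def mca_horn_mca Tnd_mca X)
qed

lemma derivable_model_mca_iff:
  assumes "horn P"
  shows "derivable_model (mca P) N \<longleftrightarrow> N = (\<Union>n. (T P ^^ n) {})"
  by (auto simp: derivable_model_def computation_mca_iff [OF assms])

text \<open>Compactness: finitely many elements enter the chain at finitely many stages, and the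
  latest stage contains them all.\<close>

lemma finite_subset_incseq_UN:
  fixes X :: "nat \<Rightarrow> 'a set"
  assumes "mono X" and "finite A" and "A \<subseteq> (\<Union>n. X n)"
  shows "\<exists>n. A \<subseteq> X n"
  using assms(2,3)
proof (induction A rule: finite_induct)
  case (insert a A)
  then obtain m n where "A \<subseteq> X m" and "a \<in> X n"
    by auto
  moreover have "X m \<subseteq> X (max m n)" and "X n \<subseteq> X (max m n)"
    using \<open>mono X\<close> by (simp_all add: monoD)
  ultimately show ?case
    by blast
qed simp

lemma least_model_T_iterates:
  assumes "horn P"
  shows "least_model P (\<Union>n. (T P ^^ n) {})"
proof -
  let ?X = "\<lambda>n. (T P ^^ n) {}"
  have "head r \<in> (\<Union>n. ?X n)" if r: "r \<in> P" "sat_body (\<Union>n. ?X n) r" for r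
  proof -
    have "set (pos r) \<subseteq> (\<Union>n. ?X n)"
      using r(2) by (auto simp: sat_body_def)
    \<comment> \<open>The finite body holds at some stage \<open>n\<close>, so the head appears one
      stage later.\<close>
    then obtain n where "set (pos r) \<subseteq> ?X n"
      using finite_subset_incseq_UN [OF incseq_T_iterates [OF assms]] by blast
    then have "head r \<in> ?X (Suc n)"
      using r(1) assms by (auto simp: T_def sat_body_def horn_def)
    then show ?thesis
      by blast
  qed
  moreover have "?X n \<subseteq> N" if N: "model P N" for N n
  proof (induction n)
    case (Suc n)
    then have "T P (?X n) \<subseteq> T P N"
      by (rule monoD [OF mono_T [OF assms]])
    then show ?case
      using N by (simp add: model_iff_T_subset)
  qed simp
  ultimately show ?thesis
    \<comment> \<open>\<open>model\<close> is unfolded only at the union, leaving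
      \<open>model P N\<close> folded to match the minimality fact.\<close>
    unfolding least_model_def model_def [of P "\<Union>n. ?X n"] by blast
qed

lemma least_model_unique: "least_model P M \<Longrightarrow> least_model P N \<Longrightarrow> M = N"
  by (auto simp: least_model_def)

lemma derivable_model_mca:
  assumes "horn P"
  shows "derivable_model (mca P) N \<longleftrightarrow> least_model P N"
  using derivable_model_mca_iff [OF assms] least_model_T_iterates [OF assms]
  by (metis least_model_unique)

text \<open>Makes the Horn results available for stable models of arbitrary programs.\<close>

lemma horn_reduct: "horn (reduct P M)"
  by (auto simp: horn_def reduct_def)

lemma mca_stable_model_mca: "mca_stable_model (mca P) M \<longleftrightarrow> stable_model P M"
  by (simp add: mca_stable_model_def stable_model_def mca_reduct_mca
      derivable_model_mca [OF horn_reduct])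

theorem theorem4:
  fixes P :: "'a program" and M :: "'a set"
  shows "(horn P \<longleftrightarrow> mca_horn (mca P))
    \<and> (horn P \<longrightarrow> (\<exists>L. least_model P L \<and> {N. derivable_model (mca P) N} = {L}))
    \<and> {T P M} = Tnd (mca P) M
    \<and> mca (reduct P M) = mca_reduct (mca P) M
    \<and> (model P M \<longleftrightarrow> mca_model (mca P) M)
    \<and> (supported_model P M \<longleftrightarrow> mca_supported_model (mca P) M)
    \<and> (stable_model P M \<longleftrightarrow> mca_stable_model (mca P) M)"
proof -
  \<comment> \<open>The witness is the union of the iterates of \<open>T P\<close> from
    \<open>{}\<close>.\<close>
  have "\<exists>L. least_model P L \<and> {N. derivable_model (mca P) N} = {L}" if "horn P"
    using least_model_T_iterates [OF that] by (auto simp: derivable_model_mca_iff [OF that])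
  then show ?thesis
    by (simp add: mca_horn_mca Tnd_mca mca_reduct_mca mca_model_mca mca_supported_model_mca
        mca_stable_model_mca)
qed

end
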